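(* Let $Z$ denote a standard normal random variable, i.e. $Z\sim\mathcal{N}(0,1)$. For each positive integer $n$ let $X_n$ be the number of permutations needed for the shuffling-and-merging process started from $[n]=\{1,\ldots,n\}$ to end. Then, as $n\to+\infty$, $$\frac{X_n-n}{\sqrt{n}}\ \stackrel{w}{\longrightarrow}\ Z,$$ where $\stackrel{w}{\longrightarrow}$ denotes weak convergence (convergence in distribution).
   Context: The process. For a positive integer $n$, take a uniformly random permutation $\tau=(\tau(1),\ldots,\tau(n))$ of $[n]=\{1,2,\ldots,n\}$. A block of $\tau$ is a maximal sequence of (increasing) consecutive integers $a,a+1,\ldots,a+r$ ($r\ge 0$) that appear, in this order, in adjacent positions of $\tau$. For example, the blocks of $(1,7,5,6,8,10,9,2,3,4)$ are $(1),(7),(5,6),(8),(10),(9),(2,3,4)$. Each block is merged into its first integer, and after all the merges the elements of the new set are relabeled from $1$ to the current number of elements, giving $[k]$ where $k$ is the number of blocks. One then takes a new, independent, uniformly random permutation of $[k]$, merges again, and so on, until only one integer is left. $X_n$ is the number of permutations used until the process ends; by convention $X_1=0$. Equivalently, for $n\ge 2$, $X_n$ has the law of $1+\widetilde X_{Y_n}$, where $Y_n$ is the number of blocks in a uniformly random permutation of $[n]$ and the $\widetilde X_k$ ($1\le k\le n$) are independent of $Y_n$ and of each other, with $\widetilde X_k$ distributed as $X_k$. *)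

theory Defs
  imports "HOL-Probability.Probability" "HOL-Library.Sublist"
    "HOL-Combinatorics.Multiset_Permutations"
begin

text \<open>
  A permutation of \<open>{1..n}\<close> is given in one-line notation, as the list of its values
  (an element of \<^term>\<open>permutations_of_set {1..n}\<close>).
\<close>

definition is_run :: "nat list \<Rightarrow> nat list \<Rightarrow> bool" where
  "is_run \<tau> xs \<longleftrightarrow> (\<exists>a r. xs = [a..<a + r + 1]) \<and> sublist xs \<tau>"

definition blocks :: "nat list \<Rightarrow> nat list set" where
  "blocks \<tau> = {xs. is_run \<tau> xs \<and> \<not> (\<exists>ys. is_run \<tau> ys \<and> strict_sublist xs ys)}"

definition num_blocks :: "nat list \<Rightarrow> nat" where
  "num_blocks \<tau> = card (blocks \<tau>)"

text \<open>
  \<open>\<tau> t k\<close> is the permutation of \<open>{1..k}\<close> that is used in round \<open>t\<close> (counting from \<open>0\<close>) if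
  \<open>k\<close> integers are left at that moment. After merging and relabeling, the new ground set is
  \<open>{1..j}\<close>, where \<open>j\<close> is the number of blocks, so the state is just the number of integers left.
\<close>

primrec num_left :: "(nat \<Rightarrow> nat \<Rightarrow> nat list) \<Rightarrow> nat \<Rightarrow> nat \<Rightarrow> nat" where
  "num_left \<tau> n 0 = n"
| "num_left \<tau> n (Suc t) = num_blocks (\<tau> t (num_left \<tau> n t))"

text \<open>
  If the process never ends (an event of probability \<open>0\<close> for uniformly random permutations and
  \<open>n \<ge> 1\<close>), the value below is an unspecified natural number.
\<close>

definition num_permutations_used :: "(nat \<Rightarrow> nat \<Rightarrow> nat list) \<Rightarrow> nat \<Rightarrow> nat" where
  "num_permutations_used \<tau> n = (LEAST t. num_left \<tau> n t = 1)"

end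

theory Submission
  imports Defs "HOL-Real_Asymp.Real_Asymp"
begin

text \<open>
  Let \<open>Y\<^sub>n\<close> be the number of blocks of a uniformly random permutation of \<open>[n]\<close>. The drop
  \<open>S\<^sub>n = n - Y\<^sub>n\<close> counts the adjacent pairs \<open>a, a + 1\<close> and has \<open>j\<close>-th factorial moment
  \<open>(n - j) / n\<close> for \<open>j \<le> n\<close>, so it is Poisson(1) up to an error of order \<open>1 / n\<close>:
  \<open>E (1 + u)\<^bsup>S\<^sub>n\<^esup>\<close> differs from \<open>e\<^sup>u\<close> by at most \<open>\<bar>u\<bar> e\<^bsup>\<bar>u\<bar>\<^esup> / n\<close>.

  The characteristic function \<open>\<phi>\<^sub>n(\<theta>)\<close> of \<open>X\<^sub>n\<close> satisfies \<open>\<phi>\<^sub>n = e\<^bsup>i\<theta>\<^esup> E \<phi>\<^bsub>Y\<^sub>n\<^esub>\<close>. If the drops were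
  exactly Poisson(1), then \<open>g\<^sub>n = (1 - i\<theta>)\<^bsup>-n\<^esup>\<close> would solve this recursion; in fact it does so with
  an error of at most \<open>\<bar>\<theta>\<bar> e\<^bsup>\<bar>\<theta>\<bar>\<^esup> / n\<close>. A comparison with twice the harmonic numbers gives
  \<open>\<bar>\<phi>\<^sub>n - g\<^sub>n\<bar> \<le> 2 \<bar>\<theta>\<bar> e\<^bsup>\<bar>\<theta>\<bar>\<^esup> H\<^sub>n\<close>. For \<open>\<theta> = s / \<surd>n\<close> this is of order \<open>log n / \<surd>n\<close>, while
  \<open>e\<^bsup>-i\<theta>n\<^esup> g\<^sub>n\<close> tends to \<open>e\<^bsup>-s\<^sup>2/2\<^esup>\<close>; Levy's continuity theorem concludes.
\<close>

section \<open>Blocks and successions of a permutation\<close>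

fun successions :: "nat list \<Rightarrow> nat" where
  "successions (x # y # zs) = of_bool (y = Suc x) + successions (y # zs)"
| "successions _ = 0"

lemma successions_append:
  "successions (xs @ ys) = successions xs + successions ys +
     of_bool (xs \<noteq> [] \<and> ys \<noteq> [] \<and> hd ys = Suc (last xs))"
proof (induction xs rule: successions.induct)
  case (1 x y zs)
  then show ?case by simp
next
  case ("2_1")
  then show ?case by simp
next
  case ("2_2" v)
  then show ?case by (cases ys) auto
qed

lemma successions_conv_card:
  "successions xs = card {i. 0 < i \<and> i < length xs \<and> xs ! i = Suc (xs ! (i - 1))}"
proof (induction xs rule: rev_induct)
  case Nil
  then show ?case by simp
next
  case (snoc x xs)
  let ?J = "\<lambda>xs. {i. 0 < i \<and> i < length xs \<and> xs ! i = Suc (xs ! (i - 1))}"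
  have "?J (xs @ [x]) = ?J xs \<union> (if xs \<noteq> [] \<and> x = Suc (last xs) then {length xs} else {})"
    by (cases "xs = []") (auto simp: nth_append less_Suc_eq last_conv_nth split: if_splits)
  moreover have "finite (?J xs)" by simp
  ultimately show ?case
    using snoc by (auto simp: successions_append card_insert_if)
qed

lemma successions_le: "successions xs \<le> length xs - 1"
  by (induction xs rule: successions.induct) auto

text \<open>An entry of a distinct list occurs once, so a succession is identified by its lower
  value \<open>a\<close>. Counting values instead of positions fits the description of blocks by
  their first entries.\<close>

lemma card_succession_values:
  "distinct xs \<Longrightarrow> card {a. sublist [a, Suc a] xs} = successions xs"
proof (induction xs rule: successions.induct)
  case (1 x y zs)
  have eq: "{a. sublist [a, Suc a] (x # y # zs)} =
      (if y = Suc x then {x} else {}) \<union> {a. sublist [a, Suc a] (y # zs)}"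
    by (subst sublist_Cons_right) auto
  have x: "\<not> sublist [x, Suc x] (y # zs)"
    using 1(2) set_mono_sublist by fastforce
  have fin: "finite {a. sublist [a, Suc a] (y # zs)}"
    by (rule finite_subset[of _ "set (y # zs)"]) (use set_mono_sublist in fastforce)+
  show ?case unfolding eq using 1 x fin by (auto simp: card_insert_if)
qed (auto simp: sublist_Cons_right)

lemma is_runE:
  assumes "is_run \<tau> xs"
  obtains a b where "xs = [a..<b]" "a < b" "sublist xs \<tau>"
proof -
  from assms obtain a r where "xs = [a..<a + r + 1]" "sublist xs \<tau>" unfolding is_run_def by blast
  then show thesis using that[of a "a + r + 1"] by simp
qed

lemma is_run_upt: "a < b \<Longrightarrow> sublist [a..<b] \<tau> \<Longrightarrow> is_run \<tau> [a..<b]"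
  unfolding is_run_def by (intro conjI exI[of _ a] exI[of _ "b - a - 1"]) auto

lemma upt_strict_sublist:
  assumes "a \<le> b" "b < c" shows "strict_sublist [a..<b] [a..<c]"
proof -
  have "[a..<c] = [a..<b] @ [b..<c]"
    using assms by (metis le_add_diff_inverse less_imp_le upt_add_eq_append)
  then show ?thesis using assms by (simp add: strict_sublist_def)
qed

text \<open>Two runs with the same head are nested, so by maximality the head determines the block.
  An entry heads a block exactly when its predecessor value does not stand right before it;
  otherwise the run extends to the left.\<close>

lemma bij_betw_hd_blocks:
  assumes "distinct \<tau>"
  shows "bij_betw hd (blocks \<tau>) (set \<tau> - Suc ` {a. sublist [a, Suc a] \<tau>})"
  unfolding bij_betw_def
proof (intro conjI equalityI subsetI)
  show "inj_on hd (blocks \<tau>)"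
  proof (rule inj_onI)
    fix xs ys assume xs: "xs \<in> blocks \<tau>" and ys: "ys \<in> blocks \<tau>" and hd: "hd xs = hd ys"
    from xs obtain a b where x: "xs = [a..<b]" "a < b" by (auto simp: blocks_def elim: is_runE)
    from ys obtain a' b' where y: "ys = [a'..<b']" "a' < b'" by (auto simp: blocks_def elim: is_runE)
    have [simp]: "a' = a" using x y hd by simp
    have "\<not> b < b'" "\<not> b' < b"
      using xs ys x y upt_strict_sublist[of a b b'] upt_strict_sublist[of a b' b] by (auto simp: blocks_def)
    then show "xs = ys" using x y by simp
  qed
next
  fix a assume "a \<in> hd ` blocks \<tau>"
  then obtain xs where xs: "xs \<in> blocks \<tau>" "a = hd xs" by auto
  then obtain b where x: "xs = [a..<b]" "a < b" "sublist xs \<tau>" by (auto simp: blocks_def elim!: is_runE)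
  have "a \<in> set \<tau>" using x set_mono_sublist by fastforce
  moreover have "\<not> sublist [c, Suc c] \<tau>" if "a = Suc c" for c
  proof
    assume "sublist [c, Suc c] \<tau>"
    then obtain ps ss where "\<tau> = ps @ [c, Suc c] @ ss" unfolding sublist_def by blast
    then have \<tau>1: "\<tau> = ps @ [c, a] @ ss" using that by simp
    obtain ps' ss' where \<tau>2: "\<tau> = ps' @ xs @ ss'" using x(3) by (auto simp: sublist_def)
    have xs_eq: "xs = a # [Suc a..<b]" using x by (simp add: upt_conv_Cons)
    have "(ps @ [c]) @ a # ss = ps' @ a # ([Suc a..<b] @ ss')" using \<tau>1 \<tau>2 xs_eq by simp
    \<comment> \<open>Distinctness forces the two occurrences of \<open>a\<close> to coincide, so
      \<open>c\<close> stands right before \<open>xs\<close>.\<close>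
    then have "ps' = ps @ [c]"
      using assms \<tau>1 \<tau>2 xs_eq by (subst (asm) append_Cons_eq_iff) auto
    then have "\<tau> = ps @ [c..<b] @ ss'" using \<tau>2 x that by (simp add: upt_conv_Cons[of c])
    then have "is_run \<tau> [c..<b]" using x that by (intro is_run_upt) auto
    moreover have "strict_sublist xs [c..<b]"
      using x that by (auto simp: strict_sublist_def upt_conv_Cons[of c] sublist_Cons_right)
    ultimately show False using xs by (auto simp: blocks_def)
  qed
  ultimately show "a \<in> set \<tau> - Suc ` {a. sublist [a, Suc a] \<tau>}" by auto
next
  fix a assume a: "a \<in> set \<tau> - Suc ` {a. sublist [a, Suc a] \<tau>}"
  \<comment> \<open>The longest run starting at \<open>a\<close> will be the block; it exists
    because no run is longer than \<open>\<tau>\<close>.\<close>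
  define B where "B = {b. a < b \<and> sublist [a..<b] \<tau>}"
  have "B \<subseteq> {..a + length \<tau>}" unfolding B_def using sublist_length_le by fastforce
  then have fin: "finite B" using finite_subset by blast
  have "sublist [a..<Suc a] \<tau>" using a by (auto simp: sublist_def in_set_conv_decomp)
  then have "B \<noteq> {}" by (auto simp: B_def)
  define b where "b = Max B"
  have b: "b \<in> B" "\<And>c. c \<in> B \<Longrightarrow> c \<le> b" using fin \<open>B \<noteq> {}\<close> by (auto simp: b_def)
  have "[a..<b] \<in> blocks \<tau>"
    unfolding blocks_def
  proof (clarify, intro conjI notI)
    show "is_run \<tau> [a..<b]" using b by (intro is_run_upt) (auto simp: B_def)
  next
    assume "\<exists>ys. is_run \<tau> ys \<and> strict_sublist [a..<b] ys"
    then obtain ys where ys: "is_run \<tau> ys" "strict_sublist [a..<b] ys" by blast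
    then obtain c d where y: "ys = [c..<d]" "c < d" "sublist ys \<tau>" by (auto elim: is_runE)
    have "set [a..<b] \<subseteq> set ys" using ys set_mono_sublist unfolding strict_sublist_def by blast
    moreover have "a < b" using b by (auto simp: B_def)
    ultimately have cd: "c \<le> a" "b \<le> d" using y b by (auto simp: ivl_subset)
    show False
    \<comment> \<open>A longer run either starts at \<open>a\<close>, against the choice of
      \<open>b\<close>, or starts earlier and then contains the succession ending in
      \<open>a\<close>.\<close>
    proof (cases "c = a")
      case True
      then have "d \<in> B" using y by (simp add: B_def)
      then have "d = b" using b cd by force
      then show False using ys y True by (simp add: strict_sublist_def)
    next
      case False
      then obtain e where e: "a = Suc e" "c \<le> e" using cd by (cases a) auto
      have "[c..<d] = [c..<e] @ [e..<d]"
        using e cd \<open>a < b\<close> upt_add_eq_append[of c e "d - e"] by simp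
      also have "[e..<d] = [e, Suc e] @ [Suc (Suc e)..<d]"
        using e cd \<open>a < b\<close> by (simp add: upt_conv_Cons)
      finally have "sublist [e, Suc e] ys" using y(1) by (metis sublist_appendI)
      then have "sublist [e, Suc e] \<tau>" using y(3) by (meson sublist_order.order.trans)
      then show False using a e by auto
    qed
  qed
  then show "a \<in> hd ` blocks \<tau>" using b by (intro image_eqI[of _ _ "[a..<b]"]) (auto simp: B_def)
qed

lemma num_blocks_conv_successions:
  assumes "distinct \<tau>"
  shows "num_blocks \<tau> = length \<tau> - successions \<tau>"
proof -
  let ?A = "{a. sublist [a, Suc a] \<tau>}"
  have sub: "Suc ` ?A \<subseteq> set \<tau>" using set_mono_sublist by fastforce
  have "num_blocks \<tau> = card (set \<tau> - Suc ` ?A)"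
    unfolding num_blocks_def using bij_betw_same_card[OF bij_betw_hd_blocks[OF assms]] .
  also have "\<dots> = card (set \<tau>) - card (Suc ` ?A)"
    using sub finite_subset[OF sub] by (intro card_Diff_subset) auto
  also have "card (Suc ` ?A) = card ?A" by (simp add: card_image)
  finally show ?thesis using assms by (simp add: card_succession_values distinct_card)
qed

section \<open>Factorial moments of the number of successions, by inserting the maximum\<close>

lemma bij_betw_insert_permutations:
  assumes "finite A" "x \<notin> A"
  shows "bij_betw (\<lambda>(xs, i). take i xs @ x # drop i xs)
    (permutations_of_set A \<times> {..card A}) (permutations_of_set (insert x A))"
  (is "bij_betw ?f ?D ?R")
  unfolding bij_betw_def
proof
  show "inj_on ?f ?D"
  proof (rule inj_onI, clarify)
    fix xs i ys j
    assume xs: "xs \<in> permutations_of_set A" and ys: "ys \<in> permutations_of_set A"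
      and ij: "i \<le> card A" "j \<le> card A"
      and eq: "take i xs @ x # drop i xs = take j ys @ x # drop j ys"
    have len: "length xs = card A" "length ys = card A"
      using xs ys length_finite_permutations_of_set by auto
    have nin: "x \<notin> set xs" "x \<notin> set ys" using xs ys assms by (auto dest: permutations_of_setD)
    have "take i xs = take j ys \<and> drop i xs = drop j ys"
      using eq nin by (subst (asm) append_Cons_eq_iff) (auto dest: in_set_takeD in_set_dropD)
    then show "xs = ys \<and> i = j" using len ij
      by (metis append_take_drop_id length_take min.absorb2)
  qed
  show "?f ` ?D = ?R"
  proof (intro equalityI subsetI)
    fix zs assume "zs \<in> ?f ` ?D"
    then obtain xs i where xs: "xs \<in> permutations_of_set A" and zs: "zs = take i xs @ x # drop i xs" by auto
    have "mset zs = mset xs + {#x#}" unfolding zs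
      by (metis add_mset_add_single append_take_drop_id mset.simps(2) mset_append union_mset_add_mset_right)
    then have "mset zs = mset (x # xs)" by simp
    moreover have "distinct (x # xs)" "set (x # xs) = insert x A" using xs assms by (auto dest: permutations_of_setD)
    ultimately show "zs \<in> ?R"
      by (metis mset_eq_imp_distinct_iff mset_eq_setD permutations_of_setI)
  next
    fix zs assume "zs \<in> ?R"
    then have z: "set zs = insert x A" "distinct zs" by (auto dest: permutations_of_setD)
    then obtain ps ss where zs: "zs = ps @ x # ss" by (metis insertI1 split_list)
    have p: "ps @ ss \<in> permutations_of_set A" using z assms zs by (intro permutations_of_setI) auto
    then have "length ps \<le> card A" using length_finite_permutations_of_set by fastforce
    then show "zs \<in> ?f ` ?D" using zs p by (intro image_eqI[of _ _ "(ps @ ss, length ps)"]) auto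
  qed
qed

text \<open>The new maximum starts no succession, so only the neighbours of slot \<open>i\<close>
  matter: a succession across the slot is broken, and one is created if \<open>n\<close> stands on
  the left. The two cases exclude each other because no entry of \<open>xs\<close> exceeds
  \<open>n\<close>.\<close>

lemma successions_insert:
  assumes "xs \<in> permutations_of_set {1..n}" "i \<le> n" "n \<ge> 1"
  shows "successions (take i xs @ Suc n # drop i xs) =
     (if 0 < i \<and> i < length xs \<and> xs ! i = Suc (xs ! (i - 1)) then successions xs - 1
      else if i > 0 \<and> xs ! (i - 1) = n then Suc (successions xs) else successions xs)"
proof -
  have len: "length xs = n" using assms length_finite_permutations_of_set by fastforce
  have hdd: "drop i xs \<noteq> [] \<Longrightarrow> hd (drop i xs) = xs ! i" using len by (simp add: hd_drop_conv_nth)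
  have lst: "take i xs \<noteq> [] \<Longrightarrow> last (take i xs) = xs ! (i - 1)"
    using len assms by (subst last_conv_nth) auto
  have mem: "xs ! j \<in> {1..n}" if "j < n" for j
    using that assms(1) len by (metis nth_mem permutations_of_setD(1))
  have a: "successions (Suc n # drop i xs) = successions (drop i xs)"
  proof (cases "i < n")
    case True
    then have "drop i xs = xs ! i # drop (Suc i) xs" using len by (simp add: Cons_nth_drop_Suc)
    then show ?thesis using mem[OF True] by simp
  qed (use len in auto)
  have b: "successions xs = successions (take i xs) + successions (drop i xs) +
     of_bool (0 < i \<and> i < n \<and> xs ! i = Suc (xs ! (i - 1)))"
  proof (cases "0 < i \<and> i < n")
    case True
    then have "take i xs \<noteq> []" "drop i xs \<noteq> []" using len by auto
    then show ?thesis using successions_append[of "take i xs" "drop i xs"] hdd lst True by simp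
  next
    case False
    then have "take i xs = [] \<or> drop i xs = []" using len by auto
    then show ?thesis using successions_append[of "take i xs" "drop i xs"] False by auto
  qed
  have c: "successions (take i xs @ Suc n # drop i xs) = successions (take i xs) + successions (drop i xs) +
    of_bool (0 < i \<and> xs ! (i - 1) = n)"
  proof (cases "i = 0")
    case True
    then show ?thesis using a by simp
  next
    case False
    then have ne: "take i xs \<noteq> []" using len assms by auto
    show ?thesis
      unfolding successions_append a lst[OF ne] using False ne by (auto simp del: One_nat_def)
  qed
  show ?thesis
  proof (cases "0 < i \<and> i < n \<and> xs ! i = Suc (xs ! (i - 1))")
    case True
    then have "\<not> (0 < i \<and> xs ! (i - 1) = n)" using mem[of i] by auto
    moreover have "successions xs = Suc (successions (take i xs) + successions (drop i xs))"
      using b unfolding eqTrueI[OF True] by simp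
    ultimately show ?thesis
      unfolding c len if_P[OF True] by (simp del: One_nat_def)
  next
    case False
    then have "successions xs = successions (take i xs) + successions (drop i xs)"
      using b by (simp only: False of_bool_eq add_0_right)
    then show ?thesis
      unfolding c len if_not_P[OF False] by (simp del: One_nat_def)
  qed
qed

text \<open>
  Inserting the new maximum \<open>n + 1\<close> creates a succession at one place (right after \<open>n\<close>), destroys
  one at each of the \<open>s\<close> successions, and changes nothing at the other \<open>n - s\<close> places.
\<close>

lemma sum_successions_insert:
  fixes f :: "nat \<Rightarrow> int"
  assumes xs: "xs \<in> permutations_of_set {1..n}" and "n \<ge> 1"
  defines "s \<equiv> successions xs"
  shows "(\<Sum>i\<le>n. f (successions (take i xs @ Suc n # drop i xs))) =
    f (Suc s) + int s * f (s - 1) + (int n - int s) * f s"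
proof -
  have len: "length xs = n" using assms length_finite_permutations_of_set by fastforce
  define J where "J = {i. 0 < i \<and> i < length xs \<and> xs ! i = Suc (xs ! (i - 1))}"
  have cJ: "card J = s" and fin: "finite J"
    unfolding s_def successions_conv_card J_def by auto
  have "n \<in> set xs" using xs assms by (auto dest: permutations_of_setD)
  then obtain k where k: "k < n" "xs ! k = n" using len by (auto simp: in_set_conv_nth)
  have mem: "xs ! j \<in> {1..n}" if "j < n" for j
    using that xs len by (metis nth_mem permutations_of_setD(1))
  have kJ: "Suc k \<notin> J" using k mem[of "Suc k"] len by (auto simp: J_def)
  have dist: "distinct xs" using xs by (auto dest: permutations_of_setD)
  have uniq: "i = Suc k" if "0 < i" "i \<le> n" "xs ! (i - 1) = n" for i
  proof -
    have "i - 1 = k" using that k len dist nth_eq_iff_index_eq[of xs "i - 1" k] by auto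
    then show ?thesis using that by simp
  qed
  have sub: "insert (Suc k) J \<subseteq> {..n}" using k len by (auto simp: J_def)
  have val: "f (successions (take i xs @ Suc n # drop i xs)) =
     (if i \<in> J then f (s - 1) else if i = Suc k then f (Suc s) else f s)" if "i \<le> n" for i
  proof (cases "i \<in> J")
    case True
    then show ?thesis
      unfolding successions_insert[OF xs that assms(2)] by (simp add: J_def s_def)
  next
    case False
    then have notJ: "\<not> (0 < i \<and> i < length xs \<and> xs ! i = Suc (xs ! (i - 1)))" by (simp add: J_def)
    have iff: "i > 0 \<and> xs ! (i - 1) = n \<longleftrightarrow> i = Suc k" using uniq[of i] that k by auto
    have "successions (take i xs @ Suc n # drop i xs) = (if i = Suc k then Suc s else s)"
      unfolding successions_insert[OF xs that assms(2)] if_not_P[OF notJ] iff s_def ..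
    then show ?thesis using False by simp
  qed
  have "(\<Sum>i\<le>n. f (successions (take i xs @ Suc n # drop i xs))) =
     (\<Sum>i\<le>n. (if i \<in> J then f (s - 1) else if i = Suc k then f (Suc s) else f s))"
    by (intro sum.cong) (auto simp: val)
  also have "\<dots> = (\<Sum>i\<in>{..n}. f s + of_bool (i \<in> J) * (f (s - 1) - f s) + of_bool (i = Suc k) * (f (Suc s) - f s))"
    by (intro sum.cong) (use kJ in auto)
  also have "\<dots> = int (Suc n) * f s + int (card ({..n} \<inter> J)) * (f (s - 1) - f s) + (f (Suc s) - f s)"
    using k by (simp add: sum.distrib flip: sum_distrib_right)
  also have "{..n} \<inter> J = J" using sub by auto
  finally show ?thesis unfolding cJ by (simp add: algebra_simps)
qed

text \<open>Combinatorially: choose \<open>j\<close> of the \<open>n - 1\<close> pairs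
  \<open>a, a + 1\<close>, glue them, and arrange the \<open>n - j\<close> pieces. The proof inserts
  the maximum instead; binomial coefficients turn the insertion rule into a recursion that involves
  only \<open>j\<close> and \<open>j - 1\<close>.\<close>

lemma sum_successions_choose:
  assumes "n \<ge> 1"
  shows "(\<Sum>xs\<in>permutations_of_set {1..n}. int (successions xs choose j)) =
    int (((n - 1) choose j) * fact (n - j))"
  using assms
proof (induction n arbitrary: j rule: nat_induct_at_least)
  case base
  have "permutations_of_set {1..1::nat} = {[1]}" by simp
  then show ?case by (cases j) auto
next
  case (Suc n)
  define P where "P = permutations_of_set {1..n}"
  have ins: "{1..Suc n} = insert (Suc n) {1..n}" by auto
  have bij: "bij_betw (\<lambda>(xs, i). take i xs @ Suc n # drop i xs)
    (P \<times> {..n}) (permutations_of_set {1..Suc n})"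
    using bij_betw_insert_permutations[of "{1..n}" "Suc n"] unfolding P_def ins by simp
  \<comment> \<open>Pascal's rule for \<open>Suc s choose j\<close> and the absorption
    \<open>s * (s - 1 choose j) = (s - j) * (s choose j)\<close> remove \<open>s\<close> from the
    coefficients.\<close>
  have step: "int (Suc s choose j) + int s * int (s - 1 choose j) + (int n - int s) * int (s choose j) =
    (int n + 1 - int j) * int (s choose j) + (case j of 0 \<Rightarrow> 0 | Suc i \<Rightarrow> int (s choose i))" for s
  proof (cases j)
    case 0
    then show ?thesis by (simp add: algebra_simps)
  next
    case (Suc i)
    show ?thesis
    proof (cases s)
      case 0
      then show ?thesis using Suc by (cases i) auto
    next
      case s: (Suc r)
      have "int (Suc i) * int (Suc r choose Suc i) = int (Suc r) * int (r choose i)"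
        using Suc_times_binomial_eq[of r i] by (metis mult.commute of_nat_mult)
      then show ?thesis using Suc s by (simp add: algebra_simps)
    qed
  qed
  have "(\<Sum>xs\<in>permutations_of_set {1..Suc n}. int (successions xs choose j)) =
    (\<Sum>(xs, i)\<in>P \<times> {..n}. int (successions (take i xs @ Suc n # drop i xs) choose j))"
    by (subst sum.reindex_bij_betw[OF bij, symmetric]) (simp add: case_prod_unfold)
  also have "\<dots> = (\<Sum>xs\<in>P. \<Sum>i\<le>n. int (successions (take i xs @ Suc n # drop i xs) choose j))"
    by (simp add: sum.cartesian_product)
  also have "\<dots> = (\<Sum>xs\<in>P. (int n + 1 - int j) * int (successions xs choose j) +
      (case j of 0 \<Rightarrow> 0 | Suc i \<Rightarrow> int (successions xs choose i)))"
    by (intro sum.cong refl, subst sum_successions_insert) (use Suc step in \<open>auto simp: P_def\<close>)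
  also have "\<dots> = (int n + 1 - int j) * int (((n - 1) choose j) * fact (n - j)) +
      (case j of 0 \<Rightarrow> 0 | Suc i \<Rightarrow> int (((n - 1) choose i) * fact (n - i)))"
    using Suc.IH unfolding P_def by (cases j) (simp_all add: sum.distrib flip: sum_distrib_left)
  also have "\<dots> = int ((Suc n - 1 choose j) * fact (Suc n - j))"
  proof (cases j)
    case 0
    then show ?thesis by (simp add: algebra_simps)
  next
    case j: (Suc i)
    obtain m where m: "n = Suc m" using Suc by (cases n) auto
    show ?thesis
    proof (cases "i \<le> m")
      case True
      then obtain d where d: "m = i + d" using le_Suc_ex by blast
      show ?thesis using j m d by (simp add: algebra_simps Suc_diff_le)
    next
      case False
      then show ?thesis using j m by (simp add: binomial_eq_0)
    qed
  qed
  finally show ?case .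
qed

section \<open>The distribution of the number of blocks\<close>

definition blocks_pmf :: "nat \<Rightarrow> nat pmf" where
  "blocks_pmf n = map_pmf num_blocks (pmf_of_set (permutations_of_set {1..n}))"

lemma num_blocks_permutation:
  assumes "xs \<in> permutations_of_set {1..n}"
  shows "num_blocks xs = n - successions xs"
proof -
  have "distinct xs" "length xs = n"
    using assms length_finite_permutations_of_set[OF assms] by (auto dest: permutations_of_setD)
  then show ?thesis using num_blocks_conv_successions by simp
qed

lemma successions_permutation_le:
  assumes "xs \<in> permutations_of_set {1..n}"
  shows "successions xs \<le> n - 1"
  using assms successions_le[of xs] length_finite_permutations_of_set by fastforce

lemma num_blocks_mem:
  assumes "n \<ge> 1" "xs \<in> permutations_of_set {1..n}"
  shows "num_blocks xs \<in> {1..n}"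
  using successions_permutation_le[OF assms(2)] assms(1)
  unfolding num_blocks_permutation[OF assms(2)] by simp

lemma set_blocks_pmf: "n \<ge> 1 \<Longrightarrow> set_pmf (blocks_pmf n) \<subseteq> {1..n}"
  using num_blocks_mem by (auto simp: blocks_pmf_def)

text \<open>Kept generic in the field: the mean needs a real function, the generating function a
  complex one.\<close>

lemma expectation_blocks_pmf:
  fixes f :: "nat \<Rightarrow> 'a :: {real_normed_field, banach, second_countable_topology}"
  assumes "n \<ge> 1"
  shows "measure_pmf.expectation (blocks_pmf n) f =
    (\<Sum>xs\<in>permutations_of_set {1..n}. f (n - successions xs)) / fact n"
proof -
  have "measure_pmf.expectation (blocks_pmf n) f =
    (\<Sum>xs\<in>permutations_of_set {1..n}. f (num_blocks xs)) /\<^sub>R fact n"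
    unfolding blocks_pmf_def integral_map_pmf
    by (subst integral_measure_pmf[of "permutations_of_set {1..n}"])
       (auto simp: scaleR_sum_right inverse_eq_divide)
  also have "(\<Sum>xs\<in>permutations_of_set {1..n}. f (num_blocks xs)) =
    (\<Sum>xs\<in>permutations_of_set {1..n}. f (n - successions xs))"
    by (intro sum.cong) (auto simp: num_blocks_permutation)
  finally show ?thesis
    by (simp add: scaleR_conv_of_real divide_inverse mult.commute)
qed

text \<open>Thus the mean of \<open>S choose j\<close> for the drop \<open>S\<close> is
  \<open>(1 - j / n) / j!\<close>, against \<open>1 / j!\<close> for Poisson(1). For
  \<open>j \<ge> n\<close> both sides vanish, the right one by truncated subtraction.\<close>

lemma choose_mult_fact_div:
  assumes "n \<ge> 1"
  shows "of_nat (((n - 1) choose j) * fact (n - j)) / fact n =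
    (of_nat (n - j) / of_nat n / fact j :: 'a :: field_char_0)"
proof (cases "j < n")
  case True
  then obtain d where d: "n = Suc (j + d)" by (metis add_Suc_right less_imp_Suc_add)
  have "of_nat ((n - 1) choose j) = (fact (n - 1) / (fact j * fact (n - 1 - j)) :: 'a)"
    using True by (intro binomial_fact) auto
  then have "of_nat ((n - 1) choose j) = (fact (j + d) / (fact j * fact d) :: 'a)" using d by simp
  moreover have "fact (n - j) = (of_nat (n - j) * fact d :: 'a)" "fact n = (of_nat n * fact (j + d) :: 'a)"
    using d by (simp_all add: Suc_diff_le)
  ultimately show ?thesis using assms by (simp add: field_simps del: of_nat_Suc of_nat_add fact_Suc)
next
  case False
  then show ?thesis using assms by (simp add: binomial_eq_0)
qed

text \<open>Here \<open>n - k\<close> is the drop, and the binomial theorem reduces its powers to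
  the moments above. Terms with \<open>j < n\<close> suffice, since the drop is at most
  \<open>n - 1\<close>.\<close>

lemma blocks_pmf_gen_fun:
  fixes u :: "'a :: {real_normed_field, banach, second_countable_topology}"
  assumes "n \<ge> 1"
  shows "measure_pmf.expectation (blocks_pmf n) (\<lambda>k. (1 + u) ^ (n - k)) =
    (\<Sum>j<n. of_nat (n - j) / of_nat n / fact j * u ^ j)"
proof -
  let ?P = "permutations_of_set {1..n}"
  have "(\<Sum>xs\<in>?P. (1 + u) ^ (n - (n - successions xs))) =
    (\<Sum>xs\<in>?P. \<Sum>j<n. of_int (int (successions xs choose j)) * u ^ j)"
  proof (intro sum.cong refl)
    fix xs assume "xs \<in> ?P"
    then have le: "successions xs < n" using successions_permutation_le[of xs n] assms by simp
    then have "(1 + u) ^ (n - (n - successions xs)) = (u + 1) ^ successions xs" by (simp add: add.commute)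
    also have "\<dots> = (\<Sum>j\<le>successions xs. of_nat (successions xs choose j) * u ^ j)"
      by (simp add: binomial_ring)
    also have "\<dots> = (\<Sum>j<n. of_nat (successions xs choose j) * u ^ j)"
      using le by (intro sum.mono_neutral_left) (auto simp: binomial_eq_0)
    finally show "(1 + u) ^ (n - (n - successions xs)) =
      (\<Sum>j<n. of_int (int (successions xs choose j)) * u ^ j)" by simp
  qed
  also have "\<dots> = (\<Sum>j<n. of_int (\<Sum>xs\<in>?P. int (successions xs choose j)) * u ^ j)"
    by (subst sum.swap) (simp add: sum_distrib_right)
  also have "\<dots> = (\<Sum>j<n. of_nat (((n - 1) choose j) * fact (n - j)) * u ^ j)"
    using sum_successions_choose[OF assms] by simp
  also have "\<dots> / fact n = (\<Sum>j<n. of_nat (((n - 1) choose j) * fact (n - j)) / fact n * u ^ j)"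
    by (simp add: sum_divide_distrib)
  finally show ?thesis
    unfolding expectation_blocks_pmf[OF assms] choose_mult_fact_div[OF assms] .
qed

lemma blocks_pmf_mean:
  assumes "n \<ge> 1"
  shows "measure_pmf.expectation (blocks_pmf n) real = real n - 1 + 1 / real n"
proof -
  let ?P = "permutations_of_set {1..n}"
  have "real_of_int (\<Sum>xs\<in>?P. int (successions xs choose 1)) / fact n = real (n - 1) / real n"
    unfolding sum_successions_choose[OF assms]
    using choose_mult_fact_div[OF assms, of 1, where 'a = real] by simp
  then have *: "(\<Sum>xs\<in>?P. real (successions xs)) / fact n = real (n - 1) / real n" by simp
  have "(\<Sum>xs\<in>?P. real (n - successions xs)) = (\<Sum>xs\<in>?P. real n - real (successions xs))"
    using successions_permutation_le assms by (intro sum.cong refl) (fastforce simp: of_nat_diff)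
  also have "\<dots> = fact n * real n - (\<Sum>xs\<in>?P. real (successions xs))"
    by (simp add: sum_subtractf)
  finally show ?thesis
    unfolding expectation_blocks_pmf[OF assms] using assms *
    by (simp add: diff_divide_distrib of_nat_diff)
qed

text \<open>The \<open>j\<close>-th coefficients differ by at most \<open>(j / n) / j!\<close>, also
  for \<open>j > n\<close>, where the finite sum contributes nothing. Cancelling \<open>j\<close>
  sums these bounds to an exponential series.\<close>

lemma norm_exp_minus_gen_fun_le:
  fixes u :: complex
  assumes "n \<ge> 1"
  shows "norm (exp u - (\<Sum>j<n. of_nat (n - j) / of_nat n / fact j * u ^ j)) \<le> norm u * exp (norm u) / real n"
proof -
  have exp_sums: "(\<lambda>j. u ^ j / fact j) sums exp u"
    using exp_converges[of u] by (simp add: scaleR_conv_of_real field_simps)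
  have fin: "(\<lambda>j. of_nat (n - j) / of_nat n / fact j * u ^ j) sums
      (\<Sum>j<n. of_nat (n - j) / of_nat n / fact j * u ^ j)"
    by (intro sums_finite) auto
  have s1: "(\<lambda>j. u ^ j / fact j - of_nat (n - j) / of_nat n / fact j * u ^ j) sums
     (exp u - (\<Sum>j<n. of_nat (n - j) / of_nat n / fact j * u ^ j))"
    by (intro sums_diff exp_sums fin)
  have "(\<lambda>j. norm u ^ j / fact j) sums exp (norm u)"
    using exp_converges[of "norm u"] by (simp add: field_simps)
  then have "(\<lambda>j. norm u / real n * (norm u ^ j / fact j)) sums (norm u / real n * exp (norm u))"
    by (rule sums_mult)
  moreover have "norm u / real n * (norm u ^ j / fact j) = real (Suc j) / real n * norm u ^ Suc j / fact (Suc j)" for j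
    by (simp add: field_simps del: of_nat_Suc)
  ultimately have "(\<lambda>j. real (Suc j) / real n * norm u ^ Suc j / fact (Suc j)) sums (norm u / real n * exp (norm u))"
    by simp
  then have s2: "(\<lambda>j. real j / real n * norm u ^ j / fact j) sums (norm u / real n * exp (norm u))"
    by (subst (asm) sums_Suc_iff) simp
  have "norm (u ^ j / fact j - of_nat (n - j) / of_nat n / fact j * u ^ j) \<le> real j / real n * norm u ^ j / fact j" for j
  proof -
    have "u ^ j / fact j - of_nat (n - j) / of_nat n / fact j * u ^ j =
      of_real (1 - real (n - j) / real n) * (u ^ j / fact j)"
      by (simp add: algebra_simps)
    also have "norm \<dots> = \<bar>1 - real (n - j) / real n\<bar> * (norm u ^ j / fact j)"
      by (simp only: norm_mult norm_of_real norm_divide norm_power norm_fact)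
    also have "\<bar>1 - real (n - j) / real n\<bar> \<le> real j / real n"
      using assms by (cases "j \<le> n") (auto simp: of_nat_diff field_simps)
    then have "\<bar>1 - real (n - j) / real n\<bar> * (norm u ^ j / fact j) \<le> real j / real n * (norm u ^ j / fact j)"
      by (intro mult_right_mono) auto
    finally show ?thesis by simp
  qed
  then have "norm (exp u - (\<Sum>j<n. of_nat (n - j) / of_nat n / fact j * u ^ j)) \<le> norm u / real n * exp (norm u)"
    using norm_sums_le[OF s1 s2] by blast
  then show ?thesis by simp
qed

text \<open>Each of the \<open>n - k\<close> terms of the difference is at least
  \<open>1 / n\<close>. As an upper bound for \<open>harm k\<close> that is linear in
  \<open>k\<close>, this reduces an expectation of \<open>harm\<close> to a mean.\<close>

lemma harm_diff_ge:
  assumes "k \<le> n" "n \<ge> 1"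
  shows "(harm n :: real) - harm k \<ge> (real n - real k) / real n"
proof -
  have "{1..n} = {1..k} \<union> {k<..n}" "{1..k} \<inter> {k<..n} = {}" using assms by auto
  then have "(harm n :: real) - harm k = (\<Sum>i\<in>{k<..n}. inverse (real i))"
    unfolding harm_def by (simp add: sum.union_disjoint)
  also have "\<dots> \<ge> (\<Sum>i\<in>{k<..n}. inverse (real n))"
    using assms by (intro sum_mono) (auto intro!: le_imp_inverse_le)
  finally show ?thesis using assms by (simp add: of_nat_diff field_simps)
qed

text \<open>A supersolution that absorbs an error of \<open>1 / n\<close> per step: only the mean drop \<open>1 - 1 / n\<close> matters.\<close>

lemma expectation_harm_blocks:
  assumes "n \<ge> 2"
  shows "measure_pmf.expectation (blocks_pmf n) (\<lambda>k. 2 * harm k) + 1 / real n \<le> 2 * harm n"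
proof -
  have fin: "finite (set_pmf (blocks_pmf n))" using finite_subset[OF set_blocks_pmf[of n]] assms by simp
  note [simp] = integrable_measure_pmf_finite[OF fin]
  have "measure_pmf.expectation (blocks_pmf n) (\<lambda>k. 2 * harm k :: real) \<le>
    measure_pmf.expectation (blocks_pmf n) (\<lambda>k. 2 * (harm n - 1 + real k / real n))"
  proof (intro integral_mono_AE)
    show "AE k in blocks_pmf n. 2 * harm k \<le> 2 * (harm n - 1 + real k / real n)"
    proof (rule AE_pmfI)
      fix k assume "k \<in> set_pmf (blocks_pmf n)"
      then have "k \<le> n" using set_blocks_pmf[of n] assms by auto
      then show "2 * harm k \<le> 2 * (harm n - 1 + real k / real n)"
        using harm_diff_ge[of k n] assms by (simp add: diff_divide_distrib)
    qed
  qed simp_all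
  also have "\<dots> = 2 * (harm n - 1 + measure_pmf.expectation (blocks_pmf n) real / real n)"
    by (simp add: algebra_simps)
  also have "\<dots> = 2 * (harm n - 1 + (real n - 1 + 1 / real n) / real n)"
    using assms by (simp add: blocks_pmf_mean)
  also have "\<dots> = 2 * harm n - 2 / real n + 2 / (real n * real n)"
    using assms by (simp add: field_simps)
  \<comment> \<open>The factor 2 before \<open>harm\<close> pays off here: the gain
    \<open>2 / n\<close> covers the error \<open>1 / n\<close> and, as \<open>n \<ge> 2\<close>,
    also this term.\<close>
  also have "2 / (real n * real n) \<le> 1 / real n" using assms by (simp add: field_simps)
  finally show ?thesis by simp
qed

section \<open>The characteristic function of the number of rounds\<close>

text \<open>Apply \<open>integral_bind\<close> to the real and imaginary parts, which inherit the
  bound \<open>B\<close>.\<close>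

lemma integral_bind_pmf_bounded:
  fixes f :: "'a \<Rightarrow> complex"
  assumes "\<And>x. norm (f x) \<le> B"
  shows "measure_pmf.expectation (bind_pmf p q) f =
    measure_pmf.expectation p (\<lambda>x. measure_pmf.expectation (q x) f)"
proof -
  have int: "integrable (measure_pmf r) f" for r :: "'a pmf"
    using assms by (intro measure_pmf.integrable_const_bound[where B = B]) auto
  have int2: "integrable (measure_pmf p) (\<lambda>x. measure_pmf.expectation (q x) f)"
  proof (intro measure_pmf.integrable_const_bound[where B = B] AE_I2)
    fix x
    have "norm (measure_pmf.expectation (q x) f) \<le> measure_pmf.expectation (q x) (\<lambda>x. norm (f x))"
      by (rule integral_norm_bound)
    also have "\<dots> \<le> measure_pmf.expectation (q x) (\<lambda>x. B)"
      using int assms by (intro integral_mono) auto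
    finally show "norm (measure_pmf.expectation (q x) f) \<le> B" by simp
  qed auto
  have real: "measure_pmf.expectation (bind_pmf p q) g =
    measure_pmf.expectation p (\<lambda>x. measure_pmf.expectation (q x) g)"
    if "\<And>x. \<bar>g x\<bar> \<le> B" for g :: "'a \<Rightarrow> real"
    unfolding measure_pmf_bind
    by (rule integral_bind[where K = "count_space UNIV" and B' = 1 and B = B])
       (use that in \<open>auto simp: measure_pmf_in_subprob_algebra measure_pmf.finite_measure_axioms\<close>)
  show ?thesis
  proof (rule complex_eqI)
    show "Re (measure_pmf.expectation (bind_pmf p q) f) = Re (measure_pmf.expectation p (\<lambda>x. measure_pmf.expectation (q x) f))"
      using real[of "\<lambda>x. Re (f x)"] abs_Re_le_cmod[of "f _"] assms int int2
      by (simp add: order_trans[OF abs_Re_le_cmod])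
    show "Im (measure_pmf.expectation (bind_pmf p q) f) = Im (measure_pmf.expectation p (\<lambda>x. measure_pmf.expectation (q x) f))"
      using real[of "\<lambda>x. Im (f x)"] abs_Im_le_cmod[of "f _"] assms int int2
      by (simp add: order_trans[OF abs_Im_le_cmod])
  qed
qed

text \<open>If all mass sat at \<open>n\<close>, the mean would be \<open>n\<close>, but it is
  smaller.\<close>

lemma pmf_blocks_self_less_1:
  assumes "n \<ge> 2"
  shows "pmf (blocks_pmf n) n < 1"
proof -
  have "real n - 1 + 1 / real n = measure_pmf.expectation (blocks_pmf n) real"
    using assms by (simp add: blocks_pmf_mean)
  also have "\<dots> = (\<Sum>k\<in>{1..n}. pmf (blocks_pmf n) k * real k)"
    by (subst integral_measure_pmf[of "{1..n}"]) (use set_blocks_pmf[of n] assms in auto)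
  also have "\<dots> \<ge> (\<Sum>k\<in>{n}. pmf (blocks_pmf n) k * real k)"
    using assms by (intro sum_mono2) auto
  finally have "pmf (blocks_pmf n) n * real n \<le> real n - 1 + 1 / real n" by simp
  also have "\<dots> < real n" using assms by (simp add: field_simps)
  finally show ?thesis using assms by simp
qed

text \<open>A subsolution \<open>D\<close> is compared with a supersolution \<open>B\<close> by
  strong induction. The chain may stay at \<open>n\<close>, so the expectations contain the values
  at \<open>n\<close> themselves; moving these across leaves the positive factor
  \<open>1 - ?p n\<close>.\<close>

lemma blocks_pmf_max_principle:
  fixes D B :: "nat \<Rightarrow> real"
  assumes base: "D 1 \<le> B 1"
    and sub: "\<And>n. n \<ge> 2 \<Longrightarrow> D n \<le> measure_pmf.expectation (blocks_pmf n) D + c n"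
    and super: "\<And>n. n \<ge> 2 \<Longrightarrow> measure_pmf.expectation (blocks_pmf n) B + c n \<le> B n"
    and "n \<ge> 1"
  shows "D n \<le> B n"
  using \<open>n \<ge> 1\<close>
proof (induction n rule: less_induct)
  case (less n)
  show ?case
  proof (cases "n = 1")
    case False
    then have n: "n \<ge> 2" using less.prems by simp
    let ?p = "pmf (blocks_pmf n)"
    have expand: "measure_pmf.expectation (blocks_pmf n) f = ?p n * f n + (\<Sum>k\<in>{1..<n}. ?p k * f k)"
      for f :: "nat \<Rightarrow> real"
    proof -
      have "measure_pmf.expectation (blocks_pmf n) f = (\<Sum>k\<in>{1..n}. ?p k * f k)"
        by (subst integral_measure_pmf[of "{1..n}"]) (use set_blocks_pmf[of n] n in auto)
      also have "{1..n} = insert n {1..<n}" using n by auto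
      finally show ?thesis by simp
    qed
    have "(\<Sum>k\<in>{1..<n}. ?p k * D k) \<le> (\<Sum>k\<in>{1..<n}. ?p k * B k)"
      using less.IH by (intro sum_mono mult_left_mono) auto
    then have "(1 - ?p n) * D n \<le> (1 - ?p n) * B n"
      using sub[OF n] super[OF n] unfolding expand by (simp add: algebra_simps)
    then show ?thesis using pmf_blocks_self_less_1[OF n] by simp
  qed (use base in simp)
qed

lemma norm_one_minus_ii_ge_1: "norm (1 - \<i> * of_real \<theta>) \<ge> 1"
  using complex_Re_le_cmod[of "1 - \<i> * of_real \<theta>"] by simp

text \<open>The laws \<open>P n\<close> enter only through their recursion, which keeps the analysis
  apart from the probability space.\<close>

lemma char_fun_approx:
  fixes P :: "nat \<Rightarrow> nat pmf" and \<theta> :: real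
  assumes P_1: "P 1 = return_pmf 0"
    and P_step: "\<And>n. n \<ge> 2 \<Longrightarrow> P n = map_pmf Suc (bind_pmf (blocks_pmf n) P)"
    and "n \<ge> 1"
  shows "norm (measure_pmf.expectation (P n) (\<lambda>t. iexp (\<theta> * real t)) - inverse (1 - \<i> * of_real \<theta>) ^ n)
    \<le> \<bar>\<theta>\<bar> * exp \<bar>\<theta>\<bar> * (2 * harm n)"
proof -
  define \<phi> where "\<phi> n = measure_pmf.expectation (P n) (\<lambda>t. iexp (\<theta> * real t))" for n
  \<comment> \<open>With this choice \<open>exp u\<close> is the inverse of the factor
    \<open>iexp \<theta>\<close> of one round, and \<open>g k\<close> is the characteristic function
    of a sum of \<open>k\<close> independent standard exponential variables.\<close>
  define u where "u = - \<i> * of_real \<theta>"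
  define g where "g k = inverse (1 + u) ^ k" for k :: nat
  define C where "C = \<bar>\<theta>\<bar> * exp \<bar>\<theta>\<bar>"
  have u1: "norm (1 + u) \<ge> 1" using norm_one_minus_ii_ge_1[of \<theta>] by (simp add: u_def)
  then have u0: "1 + u \<noteq> 0" by auto
  have norm_u: "norm u = \<bar>\<theta>\<bar>" by (simp add: u_def norm_mult)
  have norm_g: "norm (g k) \<le> 1" for k
    unfolding g_def norm_power norm_inverse using u1 by (intro power_le_one) (auto simp: inverse_le_1_iff)
  have "norm (\<phi> n - g n) \<le> C * (2 * harm n)"
  proof (rule blocks_pmf_max_principle[where D = "\<lambda>n. norm (\<phi> n - g n)" and B = "\<lambda>n. C * (2 * harm n)" and c = "\<lambda>n. C / real n"])
    show "norm (\<phi> 1 - g 1) \<le> C * (2 * harm 1)"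
    proof -
      have "\<phi> 1 - g 1 = u * inverse (1 + u)" using P_1 u0 by (simp add: \<phi>_def g_def field_simps)
      then have "norm (\<phi> 1 - g 1) = \<bar>\<theta>\<bar> * norm (g 1)" by (simp add: norm_mult norm_u g_def)
      also have "\<dots> \<le> \<bar>\<theta>\<bar> * (exp \<bar>\<theta>\<bar> * 2)"
        using norm_g[of 1] one_le_exp_iff[of "\<bar>\<theta>\<bar>"]
        by (intro mult_left_mono) (linarith, simp)
      finally show ?thesis by (simp add: C_def harm_def)
    qed
  next
    fix n :: nat assume n: "n \<ge> 2"
    let ?E = "\<lambda>f :: nat \<Rightarrow> complex. measure_pmf.expectation (blocks_pmf n) f"
    have fin: "finite (set_pmf (blocks_pmf n))" using finite_subset[OF set_blocks_pmf[of n]] n by simp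
    note [simp] = integrable_measure_pmf_finite[OF fin]
    have "\<phi> n = iexp \<theta> * ?E \<phi>"
    proof -
      have "\<phi> n = measure_pmf.expectation (bind_pmf (blocks_pmf n) P) (\<lambda>t. iexp (\<theta> * real (Suc t)))"
        unfolding \<phi>_def using P_step[OF n] by simp
      also have "\<dots> = ?E (\<lambda>k. measure_pmf.expectation (P k) (\<lambda>t. iexp (\<theta> * real (Suc t))))"
        by (rule integral_bind_pmf_bounded[where B = 1]) simp
      also have "(\<lambda>t. iexp (\<theta> * real (Suc t))) = (\<lambda>t. iexp \<theta> * iexp (\<theta> * real t))"
        by (simp add: fun_eq_iff algebra_simps flip: exp_add)
      finally show ?thesis by (simp add: \<phi>_def[abs_def])
    qed
    moreover have "?E g = g n * ?E (\<lambda>k. (1 + u) ^ (n - k))"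
    proof -
      have "?E g = ?E (\<lambda>k. g n * (1 + u) ^ (n - k))"
      proof (rule integral_cong_AE)
        show "AE k in blocks_pmf n. g k = g n * (1 + u) ^ (n - k)"
        proof (rule AE_pmfI)
          fix k assume "k \<in> set_pmf (blocks_pmf n)"
          then have "k \<le> n" using set_blocks_pmf[of n] n by auto
          then have "(1 + u) ^ n = (1 + u) ^ k * (1 + u) ^ (n - k)" by (simp flip: power_add)
          then show "g k = g n * (1 + u) ^ (n - k)"
            using u0 by (simp add: g_def power_inverse)
        qed
      qed auto
      then show ?thesis by simp
    qed
    \<comment> \<open>The second term is the defect of \<open>g\<close> in the recursion; it would
      vanish if the drop were exactly Poisson(1).\<close>
    ultimately have "\<phi> n - g n = iexp \<theta> * ?E (\<lambda>k. \<phi> k - g k) -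
        iexp \<theta> * g n * (iexp (- \<theta>) - ?E (\<lambda>k. (1 + u) ^ (n - k)))"
      by (simp add: algebra_simps flip: exp_add)
    also have "iexp (- \<theta>) = exp u" by (simp add: u_def)
    also have "norm (iexp \<theta> * ?E (\<lambda>k. \<phi> k - g k) - iexp \<theta> * g n * (exp u - ?E (\<lambda>k. (1 + u) ^ (n - k)))) \<le>
        norm (?E (\<lambda>k. \<phi> k - g k)) + norm (g n) * norm (exp u - ?E (\<lambda>k. (1 + u) ^ (n - k)))"
      by (rule order_trans[OF norm_triangle_ineq4]) (simp add: norm_mult)
    also have "norm (?E (\<lambda>k. \<phi> k - g k)) \<le> measure_pmf.expectation (blocks_pmf n) (\<lambda>k. norm (\<phi> k - g k))"
      by (rule integral_norm_bound)
    also have "norm (g n) * norm (exp u - ?E (\<lambda>k. (1 + u) ^ (n - k))) \<le>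
        1 * norm (exp u - ?E (\<lambda>k. (1 + u) ^ (n - k)))"
      by (intro mult_right_mono norm_g) auto
    also have "norm (exp u - ?E (\<lambda>k. (1 + u) ^ (n - k))) \<le> norm u * exp (norm u) / real n"
      using norm_exp_minus_gen_fun_le[of n u] n by (subst blocks_pmf_gen_fun) auto
    also have "\<dots> = C / real n" by (simp add: C_def norm_u)
    finally show "norm (\<phi> n - g n) \<le> measure_pmf.expectation (blocks_pmf n) (\<lambda>k. norm (\<phi> k - g k)) + C / real n"
      by simp
  next
    fix n :: nat assume n: "n \<ge> 2"
    have "C * (measure_pmf.expectation (blocks_pmf n) (\<lambda>k. 2 * harm k) + 1 / real n) \<le> C * (2 * harm n)"
      using expectation_harm_blocks[OF n] by (intro mult_left_mono) (auto simp: C_def)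
    then show "measure_pmf.expectation (blocks_pmf n) (\<lambda>k. C * (2 * harm k)) + C / real n \<le> C * (2 * harm n)"
      by (simp add: distrib_left)
  qed (rule \<open>n \<ge> 1\<close>)
  then show ?thesis by (simp add: \<phi>_def g_def C_def u_def)
qed

section \<open>Gaussian limit of the characteristic functions\<close>

lemma abs_exp_minus_linear_le:
  fixes x :: real
  assumes "x \<ge> 0"
  shows "\<bar>exp (- x) - (1 - x)\<bar> \<le> x\<^sup>2"
proof -
  have "exp (- x) \<ge> 1 - x" using exp_ge_add_one_self[of "-x"] by simp
  moreover have "exp (- x) \<le> 1 - x + x\<^sup>2"
  proof -
    \<comment> \<open>The product equals \<open>1 + x^3\<close>.\<close>
    have "1 \<le> (1 - x + x\<^sup>2) * (1 + x)"
      using assms by (simp add: algebra_simps power2_eq_square)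
    also have "\<dots> \<le> (1 - x + x\<^sup>2) * exp x"
    proof (rule mult_left_mono)
      have "1 - x + x\<^sup>2 = (x - 1/2)\<^sup>2 + 3/4" by (simp add: power2_eq_square algebra_simps)
      then show "0 \<le> 1 - x + x\<^sup>2" by simp
    qed (rule exp_ge_add_one_self)
    finally show ?thesis by (simp add: exp_minus field_simps)
  qed
  ultimately show ?thesis by simp
qed

text \<open>\<open>z\<close> is the characteristic function of a standard exponential variable minus
  its mean. With mean 0 and variance 1 it agrees with the Gaussian one to second order; the cubic
  remainder still vanishes after multiplication by \<open>n\<close> when
  \<open>\<theta> = s / sqrt n\<close>.\<close>

lemma gamma_char_factor_approx:
  fixes \<theta> :: real
  defines "z \<equiv> iexp (- \<theta>) * inverse (1 - \<i> * of_real \<theta>)"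
  shows "norm z \<le> 1" "norm (z - of_real (exp (- \<theta>\<^sup>2 / 2))) \<le> \<bar>\<theta>\<bar> ^ 3 + (1 + \<bar>\<theta>\<bar>) * \<bar>\<theta>\<bar> ^ 4"
proof -
  define v where "v = 1 - \<i> * of_real \<theta>"
  have v1: "norm v \<ge> 1" unfolding v_def by (rule norm_one_minus_ii_ge_1)
  then have v0: "v \<noteq> 0" by auto
  have inv: "norm (inverse v) \<le> 1" using v1 by (simp add: norm_inverse inverse_le_1_iff)
  show "norm z \<le> 1" using inv by (simp add: z_def norm_mult v_def)
  define r1 where "r1 = iexp (- \<theta>) - (1 - \<i> * of_real \<theta> - of_real (\<theta>\<^sup>2 / 2))"
  define r2 where "r2 = exp (- \<theta>\<^sup>2 / 2) - (1 - \<theta>\<^sup>2 / 2)"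
  have r1: "norm r1 \<le> \<bar>\<theta>\<bar> ^ 3 / 6"
    using iexp_approx1[of "-\<theta>" 2]
    by (simp add: r1_def eval_nat_numeral fact_numeral algebra_simps)
  have r2: "\<bar>r2\<bar> \<le> \<bar>\<theta>\<bar> ^ 4"
  proof -
    have "\<bar>r2\<bar> \<le> (\<theta>\<^sup>2 / 2)\<^sup>2" using abs_exp_minus_linear_le[of "\<theta>\<^sup>2 / 2"] by (simp add: r2_def)
    also have "\<dots> = \<theta> ^ 4 / 4" by (simp add: power_divide flip: power_mult)
    also have "\<dots> \<le> \<bar>\<theta>\<bar> ^ 4" by simp
    finally show ?thesis .
  qed
  have "z - of_real (exp (- \<theta>\<^sup>2 / 2)) = (iexp (- \<theta>) - v * of_real (exp (- \<theta>\<^sup>2 / 2))) * inverse v"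
    using v0 by (simp add: z_def v_def[symmetric] algebra_simps)
  \<comment> \<open>\<open>v * (1 - \<theta>^2 / 2)\<close> reproduces the Taylor polynomial of
    \<open>iexp (- \<theta>)\<close> up to the cubic term
    \<open>\<i> * \<theta>^3 / 2\<close>.\<close>
  also have "iexp (- \<theta>) - v * of_real (exp (- \<theta>\<^sup>2 / 2)) =
      r1 - \<i> * of_real (\<theta> ^ 3 / 2) - v * of_real r2"
  proof -
    have e1: "iexp (- \<theta>) = r1 + (1 - \<i> * of_real \<theta> - of_real (\<theta>\<^sup>2 / 2))" by (simp add: r1_def)
    have e2: "exp (- \<theta>\<^sup>2 / 2) = r2 + (1 - \<theta>\<^sup>2 / 2)" by (simp add: r2_def)
    show ?thesis
      unfolding e1 e2 by (simp add: v_def field_simps power2_eq_square power3_eq_cube)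
  qed
  also have "norm ((r1 - \<i> * of_real (\<theta> ^ 3 / 2) - v * of_real r2) * inverse v) \<le>
      norm (r1 - \<i> * of_real (\<theta> ^ 3 / 2) - v * of_real r2)"
    unfolding norm_mult using inv by (intro mult_left_le) auto
  also have "\<dots> \<le> norm r1 + norm (\<i> * of_real (\<theta> ^ 3 / 2)) + norm (v * of_real r2)"
    by (meson norm_triangle_ineq4 order_trans add_right_mono)
  also have "norm (\<i> * of_real (\<theta> ^ 3 / 2)) = \<bar>\<theta>\<bar> ^ 3 / 2"
    by (simp only: norm_mult norm_ii norm_of_real) (simp add: power_abs)
  also have "norm (v * of_real r2) \<le> (1 + \<bar>\<theta>\<bar>) * \<bar>\<theta>\<bar> ^ 4"
    unfolding norm_mult norm_of_real
  proof (rule mult_mono)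
    show "norm v \<le> 1 + \<bar>\<theta>\<bar>"
      unfolding v_def by (rule order_trans[OF norm_triangle_ineq4]) (simp add: norm_mult)
  qed (use r2 in auto)
  finally show "norm (z - of_real (exp (- \<theta>\<^sup>2 / 2))) \<le> \<bar>\<theta>\<bar> ^ 3 + (1 + \<bar>\<theta>\<bar>) * \<bar>\<theta>\<bar> ^ 4"
    using r1 zero_le_power[of "\<bar>\<theta>\<bar>" 3] by linarith
qed

lemma char_fun_tendsto:
  fixes P :: "nat \<Rightarrow> nat pmf" and s :: real
  assumes P_1: "P 1 = return_pmf 0"
    and P_step: "\<And>n. n \<ge> 2 \<Longrightarrow> P n = map_pmf Suc (bind_pmf (blocks_pmf n) P)"
  shows "(\<lambda>n. measure_pmf.expectation (P n) (\<lambda>t. iexp (s * ((real t - real n) / sqrt (real n)))))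
    \<longlonglongrightarrow> of_real (exp (- s\<^sup>2 / 2))"
proof -
  define a where "a = \<bar>s\<bar>"
  define b where "b n = a / sqrt (real n)" for n
  \<comment> \<open>The first summand is the error of \<open>char_fun_approx\<close>, with
    \<open>ln n + 1\<close> in place of \<open>harm n\<close>; the second is \<open>n\<close> times
    the error of one exponential factor.\<close>
  define e where "e n = b n * exp (b n) * (2 * (ln (real n) + 1)) + real n * (b n ^ 3 + (1 + b n) * b n ^ 4)" for n
  have bound: "norm (measure_pmf.expectation (P n) (\<lambda>t. iexp (s * ((real t - real n) / sqrt (real n)))) - of_real (exp (- s\<^sup>2 / 2))) \<le> e n"
    if n: "n \<ge> 1" for n
  proof -
    define \<theta> where "\<theta> = s / sqrt (real n)"
    have abs_\<theta>: "\<bar>\<theta>\<bar> = b n" by (simp add: \<theta>_def b_def a_def)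
    define \<phi> where "\<phi> = measure_pmf.expectation (P n) (\<lambda>t. iexp (\<theta> * real t))"
    define q where "q = inverse (1 - \<i> * of_real \<theta>)"
    define w where "w = exp (- \<theta>\<^sup>2 / 2)"
    have "(\<lambda>t. iexp (s * ((real t - real n) / sqrt (real n)))) =
        (\<lambda>t. iexp (- \<theta>) ^ n * iexp (\<theta> * real t))"
      by (simp add: fun_eq_iff \<theta>_def diff_divide_distrib right_diff_distrib algebra_simps flip: exp_add exp_of_nat_mult)
    then have 1: "measure_pmf.expectation (P n) (\<lambda>t. iexp (s * ((real t - real n) / sqrt (real n)))) =
        iexp (- \<theta>) ^ n * \<phi>"
      by (simp add: \<phi>_def)
    have 2: "exp (- s\<^sup>2 / 2) = w ^ n"
      using n by (simp add: w_def \<theta>_def power_divide flip: exp_of_nat_mult)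
    have "iexp (- \<theta>) ^ n * \<phi> - of_real (w ^ n) =
        iexp (- \<theta>) ^ n * (\<phi> - q ^ n) + ((iexp (- \<theta>) * q) ^ n - of_real w ^ n)"
      by (simp add: algebra_simps power_mult_distrib)
    also have "norm \<dots> \<le> norm (iexp (- \<theta>) ^ n * (\<phi> - q ^ n)) + norm ((iexp (- \<theta>) * q) ^ n - of_real w ^ n)"
      by (rule norm_triangle_ineq)
    also have "norm (iexp (- \<theta>) ^ n * (\<phi> - q ^ n)) = norm (\<phi> - q ^ n)"
      by (simp add: norm_mult norm_power)
    also have "\<dots> \<le> \<bar>\<theta>\<bar> * exp \<bar>\<theta>\<bar> * (2 * harm n)"
      unfolding \<phi>_def q_def using P_1 P_step n by (rule char_fun_approx)
    also have "\<dots> \<le> \<bar>\<theta>\<bar> * exp \<bar>\<theta>\<bar> * (2 * (ln (real n) + 1))"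
      using euler_mascheroni_sequence_decreasing[of 1 n] n by (intro mult_left_mono) (auto simp: harm_def)
    \<comment> \<open>Both bases lie in the closed unit disc, so the error of the power is at most
      \<open>n\<close> times that of the base.\<close>
    also have "norm ((iexp (- \<theta>) * q) ^ n - of_real w ^ n) \<le> real n * norm (iexp (- \<theta>) * q - of_real w)"
      using gamma_char_factor_approx(1)[of \<theta>] by (intro norm_power_diff) (auto simp: q_def w_def)
    also have "\<dots> \<le> real n * (\<bar>\<theta>\<bar> ^ 3 + (1 + \<bar>\<theta>\<bar>) * \<bar>\<theta>\<bar> ^ 4)"
      using gamma_char_factor_approx(2)[of \<theta>] by (intro mult_left_mono) (auto simp: q_def w_def)
    finally show ?thesis unfolding 1 2 e_def abs_\<theta> by simp
  qed
  have "e \<longlonglongrightarrow> 0"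
  proof (cases "a = 0")
    case True
    then have "e = (\<lambda>_. 0)" by (simp add: e_def b_def fun_eq_iff)
    then show ?thesis by simp
  next
    case False
    then have "a > 0" by (simp add: a_def)
    then show ?thesis unfolding e_def b_def by real_asymp
  qed
  then show ?thesis
    by (rule Lim_null_comparison[rotated, THEN LIM_zero_cancel])
       (use bound in \<open>auto intro!: eventually_sequentiallyI[of 1]\<close>)
qed

section \<open>The process\<close>

primrec left_pmf :: "nat \<Rightarrow> nat \<Rightarrow> nat pmf" where
  "left_pmf n 0 = return_pmf n"
| "left_pmf n (Suc t) = bind_pmf (left_pmf n t) blocks_pmf"

text \<open>The definition appends rounds at the end, following \<open>num_left\<close>, whereas the
  recursion for the number of rounds conditions on the first one.\<close>

lemma left_pmf_first_step:
  "left_pmf n (Suc t) = bind_pmf (blocks_pmf n) (\<lambda>k. left_pmf k t)"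
proof (induction t)
  case 0
  show ?case by (simp add: bind_return_pmf bind_return_pmf')
next
  case (Suc t)
  have "left_pmf n (Suc (Suc t)) = bind_pmf (left_pmf n (Suc t)) blocks_pmf" by simp
  also have "\<dots> = bind_pmf (blocks_pmf n) (\<lambda>k. left_pmf k (Suc t))"
    unfolding Suc.IH by (simp add: bind_assoc_pmf)
  finally show ?case .
qed

lemma set_left_pmf: "n \<ge> 1 \<Longrightarrow> set_pmf (left_pmf n t) \<subseteq> {1..n}"
proof (induction t)
  case (Suc t)
  show ?case
  proof
    fix j assume "j \<in> set_pmf (left_pmf n (Suc t))"
    then obtain k where k: "k \<in> set_pmf (left_pmf n t)" "j \<in> set_pmf (blocks_pmf k)" by auto
    then have "k \<in> {1..n}" using Suc by auto
    then show "j \<in> {1..n}" using k(2) set_blocks_pmf[of k] by fastforce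
  qed
qed simp

lemma left_pmf_1 [simp]: "left_pmf 1 t = return_pmf 1" "left_pmf (Suc 0) t = return_pmf 1"
  using set_left_pmf[of 1 t] by (auto simp: set_pmf_subset_singleton)

text \<open>From state \<open>k\<close> the mean of the state minus 1 shrinks in one round by the
  factor \<open>1 - 1 / k \<le> 1 - 1 / n\<close>, and a state other than 1 contributes at least 1
  to it. The common bound \<open>n\<close> on all states makes the rate uniform.\<close>

lemma left_pmf_not_1_le:
  assumes "k \<in> {1..n}"
  shows "1 - pmf (left_pmf k t) 1 \<le> real (k - 1) * (1 - 1 / real n) ^ t"
  using assms
proof (induction t arbitrary: k)
  case 0
  then show ?case by (auto simp: indicator_def)
next
  case (Suc t)
  let ?r = "1 - 1 / real n"
  have k: "k \<ge> 1" "k \<le> n" using Suc.prems by auto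
  have fin: "finite (set_pmf (blocks_pmf k))" using finite_subset[OF set_blocks_pmf[OF k(1)]] by simp
  note [simp] = integrable_measure_pmf_finite[OF fin]
  have "1 - pmf (left_pmf k (Suc t)) 1 =
      measure_pmf.expectation (blocks_pmf k) (\<lambda>j. 1 - pmf (left_pmf j t) 1)"
    unfolding left_pmf_first_step pmf_bind by simp
  also have "\<dots> \<le> measure_pmf.expectation (blocks_pmf k) (\<lambda>j. (real j - 1) * ?r ^ t)"
  proof (intro integral_mono_AE)
    show "AE j in blocks_pmf k. 1 - pmf (left_pmf j t) 1 \<le> (real j - 1) * ?r ^ t"
    proof (rule AE_pmfI)
      fix j assume "j \<in> set_pmf (blocks_pmf k)"
      then have j: "j \<in> {1..n}" using set_blocks_pmf[OF k(1)] k by fastforce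
      then show "1 - pmf (left_pmf j t) 1 \<le> (real j - 1) * ?r ^ t"
        using Suc.IH[OF j] by (simp add: of_nat_diff)
    qed
  qed simp_all
  also have "\<dots> = (measure_pmf.expectation (blocks_pmf k) real - 1) * ?r ^ t" by simp
  also have "measure_pmf.expectation (blocks_pmf k) real - 1 = real (k - 1) * (1 - 1 / real k)"
    using k by (simp add: blocks_pmf_mean of_nat_diff field_simps)
  also have "\<dots> * ?r ^ t \<le> real (k - 1) * ?r * ?r ^ t"
    using k by (intro mult_right_mono mult_left_mono zero_le_power) (auto simp: field_simps)
  finally show ?case by simp
qed

lemma left_pmf_1_tendsto:
  assumes "n \<ge> 1"
  shows "(\<lambda>t. pmf (left_pmf n t) 1) \<longlonglongrightarrow> 1"
proof -
  have "(\<lambda>t. real (n - 1) * (1 - 1 / real n) ^ t) \<longlonglongrightarrow> real (n - 1) * 0"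
    using assms by (intro tendsto_mult tendsto_const LIMSEQ_realpow_zero) (auto simp: field_simps)
  then have "(\<lambda>t. real (n - 1) * (1 - 1 / real n) ^ t) \<longlonglongrightarrow> 0" by simp
  then have "(\<lambda>t. 1 - pmf (left_pmf n t) 1) \<longlonglongrightarrow> 0"
    by (rule Lim_null_comparison[rotated])
       (use left_pmf_not_1_le[of n n] assms in \<open>auto simp: pmf_le_1\<close>)
  from tendsto_diff[OF tendsto_const[of 1] this] show ?thesis by simp
qed

section \<open>Paths of the process for given permutations\<close>

lemma num_left_cong:
  assumes "\<And>s k. s < t \<Longrightarrow> \<sigma> s k = \<sigma>' s k"
  shows "num_left \<sigma> n t = num_left \<sigma>' n t"
  using assms by (induction t) auto

lemma num_left_bounds:
  assumes "\<And>t k. k \<ge> 1 \<Longrightarrow> \<sigma> t k \<in> permutations_of_set {1..k}" "n \<ge> 1"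
  shows "num_left \<sigma> n t \<in> {1..n}"
proof (induction t)
  case (Suc t)
  then show ?case using num_blocks_mem[OF _ assms(1)[of "num_left \<sigma> n t" t]] by fastforce
qed (use assms in simp)

lemma num_left_absorbing:
  assumes "\<And>t k. k \<ge> 1 \<Longrightarrow> \<sigma> t k \<in> permutations_of_set {1..k}"
    and "num_left \<sigma> n s = 1" "s \<le> t"
  shows "num_left \<sigma> n t = 1"
  using assms(3)
proof (induction t rule: dec_induct)
  case (step t)
  then show ?case using num_blocks_mem[OF _ assms(1)[of 1 t]] by simp
qed (use assms in simp)

text \<open>Since 1 is absorbing, having hit it by time \<open>t\<close> means being there at time
  \<open>t\<close>. The second hypothesis guarantees that \<open>LEAST\<close> has a
  witness.\<close>

lemma num_permutations_used_le_iff: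
  assumes "\<And>t k. k \<ge> 1 \<Longrightarrow> \<sigma> t k \<in> permutations_of_set {1..k}"
    and "\<exists>s. num_left \<sigma> n s = 1"
  shows "num_permutations_used \<sigma> n \<le> t \<longleftrightarrow> num_left \<sigma> n t = 1"
proof
  have "num_left \<sigma> n (num_permutations_used \<sigma> n) = 1"
    unfolding num_permutations_used_def using assms(2) by (rule LeastI_ex)
  moreover assume "num_permutations_used \<sigma> n \<le> t"
  ultimately show "num_left \<sigma> n t = 1" using assms(1) by (rule num_left_absorbing[rotated])
next
  assume "num_left \<sigma> n t = 1"
  then show "num_permutations_used \<sigma> n \<le> t"
    unfolding num_permutations_used_def by (rule Least_le)
qed

text \<open>The index \<open>k\<close> of the permutation used is itself random; it takes countably
  many values, so measurability survives the composition.\<close>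

lemma num_left_measurable:
  fixes \<rho> :: "nat \<Rightarrow> nat \<Rightarrow> 'x \<Rightarrow> nat list"
  assumes "\<And>s k. s < t \<Longrightarrow> \<rho> s k \<in> measurable N (count_space UNIV)"
  shows "(\<lambda>x. num_left (\<lambda>s k. \<rho> s k x) n t) \<in> measurable N (count_space UNIV)"
  using assms
proof (induction t)
  case (Suc t)
  have "(\<lambda>x. num_blocks (\<rho> t k x)) \<in> measurable N (count_space UNIV)" for k
    using Suc.prems[of t k] by (rule measurable_compose) auto
  moreover have "(\<lambda>x. num_left (\<lambda>s k. \<rho> s k x) n t) \<in> measurable N (count_space UNIV)"
    using Suc by auto
  ultimately show ?case
    by (simp add: measurable_compose_countable[where f = "\<lambda>k x. num_blocks (\<rho> t k x)"])
qed simp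

section \<open>The process driven by independent uniform permutations\<close>

locale uniform_permutations = prob_space M for M :: "'w measure" +
  fixes \<tau> :: "nat \<Rightarrow> nat \<Rightarrow> 'w \<Rightarrow> nat list"
  assumes indep: "indep_vars (\<lambda>_. count_space UNIV) (\<lambda>(t, k). \<tau> t k) (UNIV \<times> {1..})"
    and uniform: "\<And>t k. k \<ge> 1 \<Longrightarrow>
      distr M (count_space UNIV) (\<tau> t k) = measure_pmf (pmf_of_set (permutations_of_set {1..k}))"
begin

text \<open>
  The hypotheses say nothing about the lists \<open>\<tau> t 0\<close>, which need not even be measurable;
  almost surely they are not used.
\<close>

definition guarded :: "nat \<Rightarrow> nat \<Rightarrow> 'w \<Rightarrow> nat list" where
  "guarded t k \<omega> = (if k \<ge> 1 then \<tau> t k \<omega> else [])"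

definition left :: "nat \<Rightarrow> nat \<Rightarrow> 'w \<Rightarrow> nat" where
  "left n t \<omega> = num_left (\<lambda>t k. guarded t k \<omega>) n t"

lemma permutation_measurable: "k \<ge> 1 \<Longrightarrow> \<tau> t k \<in> measurable M (count_space UNIV)"
  using indep unfolding indep_vars_def by force

lemma guarded_measurable: "guarded t k \<in> measurable M (count_space UNIV)"
  using permutation_measurable[of k t] unfolding guarded_def by (cases "k \<ge> 1") simp_all

lemma left_measurable [measurable]: "left n t \<in> measurable M (count_space UNIV)"
  unfolding left_def by (intro num_left_measurable) (rule guarded_measurable)

lemma AE_permutations: "AE \<omega> in M. \<forall>t k. k \<ge> 1 \<longrightarrow> \<tau> t k \<omega> \<in> permutations_of_set {1..k}"
proof -
  have "AE \<omega> in M. \<tau> t k \<omega> \<in> permutations_of_set {1..k}" if "k \<ge> 1" for t k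
  proof -
    have "AE x in distr M (count_space UNIV) (\<tau> t k). x \<in> permutations_of_set {1..k}"
      unfolding uniform[OF that] by (rule AE_pmfI) simp
    then show ?thesis by (subst (asm) AE_distr_iff) (use permutation_measurable[OF that] in simp_all)
  qed
  then show ?thesis by (auto simp: AE_all_countable)
qed

lemma AE_left_eq:
  assumes "n \<ge> 1"
  shows "AE \<omega> in M. \<forall>t. left n t \<omega> \<in> {1..n} \<and> left n t \<omega> = num_left (\<lambda>t k. \<tau> t k \<omega>) n t"
  using AE_permutations
proof eventually_elim
  case (elim \<omega>)
  have bounds: "num_left (\<lambda>t k. \<tau> t k \<omega>) n t \<in> {1..n}" for t
    using elim assms by (intro num_left_bounds) auto
  have "left n t \<omega> = num_left (\<lambda>t k. \<tau> t k \<omega>) n t" for t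
  proof (induction t)
    case (Suc t)
    then show ?case using bounds[of t] by (simp add: left_def guarded_def)
  qed (simp add: left_def)
  then show ?case using bounds by simp
qed

text \<open>The state after \<open>t\<close> rounds is a function of the permutations of earlier
  rounds, whose index set is disjoint from \<open>{(t, k)}\<close>.\<close>

lemma indep_left:
  assumes "k \<ge> 1"
  shows "indep_var (count_space UNIV) (left n t) (count_space UNIV) (\<lambda>\<omega>. num_blocks (\<tau> t k \<omega>))"
proof -
  let ?I = "{..<t} \<times> {1..} :: (nat \<times> nat) set" and ?J = "{(t, k)}"
  let ?N = "\<lambda>_. count_space UNIV :: nat list measure"
  \<comment> \<open>Filling with \<open>[]\<close> outside \<open>?I\<close> makes the state a
    function on \<open>PiM ?I ?N\<close>.\<close>
  let ?\<sigma> = "\<lambda>x s k. if s < t \<and> k \<ge> 1 then x (s, k) else []"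
  have "indep_var (PiM ?I ?N) (\<lambda>\<omega>. restrict (\<lambda>i. (case i of (t, k) \<Rightarrow> \<tau> t k) \<omega>) ?I)
      (PiM ?J ?N) (\<lambda>\<omega>. restrict (\<lambda>i. (case i of (t, k) \<Rightarrow> \<tau> t k) \<omega>) ?J)"
    using indep assms by (intro indep_var_restrict) auto
  moreover have "(\<lambda>x. num_left (?\<sigma> x) n t) \<in> measurable (PiM ?I ?N) (count_space UNIV)"
  proof (rule num_left_measurable)
    fix s k assume "s < t"
    then show "(\<lambda>x. if s < t \<and> k \<ge> 1 then x (s, k) else []) \<in> measurable (PiM ?I ?N) (count_space UNIV)"
      by (cases "k \<ge> 1") (auto intro!: measurable_component_singleton)
  qed
  moreover have "(\<lambda>x. num_blocks (x (t, k))) \<in> measurable (PiM ?J ?N) (count_space UNIV)"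
    by (rule measurable_compose[OF measurable_component_singleton]) auto
  ultimately have "indep_var
      (count_space UNIV) ((\<lambda>x. num_left (?\<sigma> x) n t) \<circ> (\<lambda>\<omega>. restrict (\<lambda>i. (case i of (t, k) \<Rightarrow> \<tau> t k) \<omega>) ?I))
      (count_space UNIV) ((\<lambda>x. num_blocks (x (t, k))) \<circ> (\<lambda>\<omega>. restrict (\<lambda>i. (case i of (t, k) \<Rightarrow> \<tau> t k) \<omega>) ?J))"
    by (rule indep_var_compose)
  moreover have "(\<lambda>x. num_left (?\<sigma> x) n t) \<circ> (\<lambda>\<omega>. restrict (\<lambda>i. (case i of (t, k) \<Rightarrow> \<tau> t k) \<omega>) ?I) = left n t"
    unfolding left_def by (auto simp: fun_eq_iff guarded_def intro!: num_left_cong)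
  moreover have "(\<lambda>x. num_blocks (x (t, k))) \<circ> (\<lambda>\<omega>. restrict (\<lambda>i. (case i of (t, k) \<Rightarrow> \<tau> t k) \<omega>) ?J) =
      (\<lambda>\<omega>. num_blocks (\<tau> t k \<omega>))"
    by (simp add: fun_eq_iff)
  ultimately show ?thesis by simp
qed

lemma prob_num_blocks:
  assumes "k \<ge> 1"
  shows "prob (\<tau> t k -` {x. num_blocks x = j} \<inter> space M) = pmf (blocks_pmf k) j"
proof -
  have "prob (\<tau> t k -` {x. num_blocks x = j} \<inter> space M) =
      measure (distr M (count_space UNIV) (\<tau> t k)) {x. num_blocks x = j}"
    using permutation_measurable[OF assms] by (simp add: measure_distr)
  also have "\<dots> = pmf (blocks_pmf k) j"
    unfolding uniform[OF assms] blocks_pmf_def pmf_map by (simp add: vimage_def)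
  finally show ?thesis .
qed

lemma prob_left:
  assumes "n \<ge> 1"
  shows "prob {\<omega> \<in> space M. left n t \<omega> = j} = pmf (left_pmf n t) j"
proof (induction t arbitrary: j)
  case 0
  then show ?case by (auto simp: left_def prob_space indicator_def)
next
  case (Suc t)
  \<comment> \<open>Splitting by the value \<open>k\<close> of the state replaces the random index
    of the permutation by a fixed one, so that \<open>indep_left\<close> applies.\<close>
  define A where "A k = left n t -` {k} \<inter> (\<tau> t k -` {x. num_blocks x = j}) \<inter> space M" for k
  have A: "A k \<in> events" if "k \<in> {1..n}" for k
  proof -
    have "A k = (left n t -` {k} \<inter> space M) \<inter> (\<tau> t k -` {x. num_blocks x = j} \<inter> space M)"
      by (auto simp: A_def)
    also have "\<dots> \<in> events"
      using that by (intro sets.Int measurable_sets[OF left_measurable] measurable_sets[OF permutation_measurable]) auto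
    finally show ?thesis .
  qed
  have prob_A: "prob (A k) = pmf (left_pmf n t) k * pmf (blocks_pmf k) j" if "k \<in> {1..n}" for k
  proof -
    have "A k = (\<lambda>\<omega>. (left n t \<omega>, num_blocks (\<tau> t k \<omega>))) -` ({k} \<times> {j}) \<inter> space M"
      by (auto simp: A_def)
    also have "prob \<dots> = prob (left n t -` {k} \<inter> space M) * prob ((\<lambda>\<omega>. num_blocks (\<tau> t k \<omega>)) -` {j} \<inter> space M)"
      using that by (intro indep_varD[OF indep_left]) auto
    also have "(\<lambda>\<omega>. num_blocks (\<tau> t k \<omega>)) -` {j} \<inter> space M = \<tau> t k -` {x. num_blocks x = j} \<inter> space M"
      by auto
    also have "left n t -` {k} \<inter> space M = {\<omega> \<in> space M. left n t \<omega> = k}" by auto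
    finally show ?thesis using that by (simp only: Suc.IH prob_num_blocks atLeastAtMost_iff)
  qed
  have "prob {\<omega> \<in> space M. left n (Suc t) \<omega> = j} = prob (\<Union>k\<in>{1..n}. A k)"
  proof (rule measure_eq_AE)
    show "AE \<omega> in M. (\<omega> \<in> {\<omega> \<in> space M. left n (Suc t) \<omega> = j}) = (\<omega> \<in> (\<Union>k\<in>{1..n}. A k))"
      using AE_left_eq[OF assms] AE_space
    proof eventually_elim
      case (elim \<omega>)
      then have b: "left n t \<omega> \<in> {1..n}" by blast
      have "left n (Suc t) \<omega> = num_blocks (guarded t (left n t \<omega>) \<omega>)" by (simp add: left_def)
      also have "guarded t (left n t \<omega>) \<omega> = \<tau> t (left n t \<omega>) \<omega>" using b by (simp add: guarded_def)
      finally show ?case using b elim(2) by (auto simp: A_def)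
    qed
  qed (use A in auto)
  also have "\<dots> = (\<Sum>k\<in>{1..n}. prob (A k))"
    using A by (intro finite_measure_finite_Union) (auto simp: disjoint_family_on_def A_def)
  also have "\<dots> = (\<Sum>k\<in>{1..n}. pmf (left_pmf n t) k * pmf (blocks_pmf k) j)"
    using prob_A by simp
  also have "\<dots> = pmf (left_pmf n (Suc t)) j"
    using set_left_pmf[OF assms, of t]
    by (simp add: pmf_bind) (subst integral_measure_pmf[of "{1..n}"], auto)
  finally show ?case .
qed

text \<open>For every \<open>t\<close> the event contains that of one integer being left at time
  \<open>t\<close>, and those probabilities tend to 1.\<close>

lemma AE_process_ends:
  assumes "n \<ge> 1"
  shows "AE \<omega> in M. \<exists>t. left n t \<omega> = 1"
proof -
  have "prob {\<omega> \<in> space M. \<exists>t. left n t \<omega> = 1} \<ge> pmf (left_pmf n t) 1" for t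
    unfolding prob_left[OF assms, symmetric] by (intro finite_measure_mono) auto
  then have "prob {\<omega> \<in> space M. \<exists>t. left n t \<omega> = 1} \<ge> 1"
    using left_pmf_1_tendsto[OF assms] LIMSEQ_le_const2 by blast
  then have "prob {\<omega> \<in> space M. \<exists>t. left n t \<omega> = 1} = 1"
    using prob_le_1 order_antisym by blast
  then show ?thesis by (subst (asm) prob_Collect_eq_1) auto
qed

lemma prob_num_permutations_used:
  assumes "n \<ge> 1" and X: "X \<in> measurable M (count_space UNIV)"
    and "AE \<omega> in M. X \<omega> = num_permutations_used (\<lambda>t k. \<tau> t k \<omega>) n"
  shows "prob {\<omega> \<in> space M. X \<omega> \<le> t} = pmf (left_pmf n t) 1"
proof -
  have "prob {\<omega> \<in> space M. X \<omega> \<le> t} = prob {\<omega> \<in> space M. left n t \<omega> = 1}"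
  proof (rule measure_eq_AE)
    show "AE \<omega> in M. (\<omega> \<in> {\<omega> \<in> space M. X \<omega> \<le> t}) = (\<omega> \<in> {\<omega> \<in> space M. left n t \<omega> = 1})"
      using assms(3) AE_left_eq[OF assms(1)] AE_process_ends[OF assms(1)] AE_permutations
    proof eventually_elim
      case (elim \<omega>)
      have "num_permutations_used (\<lambda>t k. \<tau> t k \<omega>) n \<le> t \<longleftrightarrow> num_left (\<lambda>t k. \<tau> t k \<omega>) n t = 1"
        using elim by (intro num_permutations_used_le_iff) auto
      then show ?case using elim by auto
    qed
  qed (use X in measurable)
  then show ?thesis using prob_left[OF assms(1)] by simp
qed

end

section \<open>The law of the number of rounds and the limit theorem\<close>

lemma measure_bind_pmf:
  "measure (bind_pmf p q) A = measure_pmf.expectation p (\<lambda>x. measure (q x) A)"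
  unfolding measure_pmf_bind
  by (subst measure_pmf.measure_bind[where N = "count_space UNIV"])
     (auto simp: measure_pmf_in_subprob_algebra)

text \<open>The process yields the law of \<open>X\<close> through the events
  \<open>X \<le> t\<close>; point masses are differences of their probabilities.\<close>

lemma nat_pmf_eqI_cdf:
  fixes p q :: "nat pmf"
  assumes "\<And>t. measure p {..t} = measure q {..t}"
  shows "p = q"
proof (rule pmf_eqI)
  have pmf_Suc: "pmf r (Suc i) = measure r {..Suc i} - measure r {..i}" for r :: "nat pmf" and i
  proof -
    have "{Suc i} = {..Suc i} - {..i}" by auto
    then have "pmf r (Suc i) = measure r ({..Suc i} - {..i})" by (metis measure_pmf_single)
    also have "\<dots> = measure r {..Suc i} - measure r {..i}"
      by (intro measure_pmf.finite_measure_Diff) auto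
    finally show ?thesis .
  qed
  have pmf_0: "pmf r 0 = measure r {..0}" for r :: "nat pmf" by (simp add: measure_pmf_single)
  show "pmf p i = pmf q i" for i
    by (cases i) (simp_all only: pmf_0 pmf_Suc assms)
qed

text \<open>The points of measure zero are countably many and so form a null set, which is what a
  pmf requires.\<close>

lemma (in prob_space) distr_count_space_pmf:
  fixes X :: "'a \<Rightarrow> 'b :: countable"
  assumes X: "X \<in> measurable M (count_space UNIV)"
  shows "\<exists>p. distr M (count_space UNIV) X = measure_pmf p"
proof -
  let ?D = "distr M (count_space UNIV) X"
  have "AE x in ?D. x = i \<longrightarrow> measure ?D {x} \<noteq> 0" for i
  proof (cases "measure ?D {i} = 0")
    case True
    interpret D: prob_space ?D using X by (rule prob_space_distr)
    have "emeasure ?D {i} = 0" using True by (simp add: D.emeasure_eq_measure)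
    then have "AE x in ?D. x \<noteq> i" by (intro AE_I[of _ _ "{i}"]) auto
    then show ?thesis by eventually_elim auto
  qed auto
  then have "AE x in ?D. \<forall>i. x = i \<longrightarrow> measure ?D {x} \<noteq> 0" by (simp only: AE_all_countable) blast
  then have "AE x in ?D. measure ?D {x} \<noteq> 0" by simp
  then have "measure_pmf (Abs_pmf ?D) = ?D"
    by (intro Abs_pmf_inverse) (auto intro: prob_space_distr X)
  then show ?thesis by metis
qed

theorem theorem1p1:
  fixes M :: "nat \<Rightarrow> 'w measure"
    and \<tau> :: "nat \<Rightarrow> nat \<Rightarrow> nat \<Rightarrow> 'w \<Rightarrow> nat list"
    and X :: "nat \<Rightarrow> 'w \<Rightarrow> nat"
  assumes "\<And>n. n \<ge> 1 \<Longrightarrow> prob_space (M n)"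
    and "\<And>n. n \<ge> 1 \<Longrightarrow>
      prob_space.indep_vars (M n) (\<lambda>_. count_space UNIV) (\<lambda>(t, k). \<tau> n t k) (UNIV \<times> {1..})"
    and "\<And>n t k. n \<ge> 1 \<Longrightarrow> k \<ge> 1 \<Longrightarrow>
      distr (M n) (count_space UNIV) (\<tau> n t k) = measure_pmf (pmf_of_set (permutations_of_set {1..k}))"
    and "\<And>n. n \<ge> 1 \<Longrightarrow> X n \<in> measurable (M n) (count_space UNIV)"
    and "\<And>n. n \<ge> 1 \<Longrightarrow>
      AE \<omega> in M n. X n \<omega> = num_permutations_used (\<lambda>t k. \<tau> n t k \<omega>) n"
  shows "weak_conv_m (\<lambda>n. distr (M n) borel (\<lambda>\<omega>. (real (X n \<omega>) - real n) / sqrt (real n)))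
    std_normal_distribution"
proof -
  \<comment> \<open>The hypotheses start at \<open>n = 1\<close>, so \<open>P 0\<close> stays
    arbitrary.\<close>
  have "\<forall>n. \<exists>p. n \<ge> 1 \<longrightarrow> distr (M n) (count_space UNIV) (X n) = measure_pmf p"
    using prob_space.distr_count_space_pmf[OF assms(1) assms(4)] by blast
  then obtain P where P: "distr (M n) (count_space UNIV) (X n) = measure_pmf (P n)" if "n \<ge> 1" for n
    by metis
  have cdf: "measure (P n) {..t} = pmf (left_pmf n t) 1" if n: "n \<ge> 1" for n t
  proof -
    interpret uniform_permutations "M n" "\<tau> n"
      using assms(1,2,3)[OF n] by (simp add: uniform_permutations_def uniform_permutations_axioms_def)
    have "measure (P n) {..t} = prob (X n -` {..t} \<inter> space (M n))"
      unfolding P[OF n, symmetric] using assms(4)[OF n] by (simp add: measure_distr)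
    also have "X n -` {..t} \<inter> space (M n) = {\<omega> \<in> space (M n). X n \<omega> \<le> t}" by auto
    finally show ?thesis using prob_num_permutations_used[OF n assms(4,5)[OF n]] by simp
  qed
  have P_1: "P 1 = return_pmf 0"
    by (rule nat_pmf_eqI_cdf) (simp add: cdf del: One_nat_def)
  have P_step: "P n = map_pmf Suc (bind_pmf (blocks_pmf n) P)" if n: "n \<ge> 2" for n
  proof (rule nat_pmf_eqI_cdf)
    fix t
    show "measure (P n) {..t} = measure (map_pmf Suc (bind_pmf (blocks_pmf n) P)) {..t}"
    proof (cases t)
      \<comment> \<open>From \<open>n \<ge> 2\<close> at least one round is needed, so both sides
        are zero.\<close>
      case 0
      have "Suc -` {..0} = {}" by auto
      then have "measure (map_pmf Suc (bind_pmf (blocks_pmf n) P)) {..t} = 0" using 0 by simp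
      then show ?thesis using n 0 by (simp add: cdf del: atMost_0)
    next
      case (Suc s)
      have "Suc -` {..Suc s} = {..s}" by auto
      then have "measure (map_pmf Suc (bind_pmf (blocks_pmf n) P)) {..t} = measure (bind_pmf (blocks_pmf n) P) {..s}"
        using Suc by simp
      also have "\<dots> = measure_pmf.expectation (blocks_pmf n) (\<lambda>k. measure (P k) {..s})"
        by (rule measure_bind_pmf)
      also have "\<dots> = measure_pmf.expectation (blocks_pmf n) (\<lambda>k. pmf (left_pmf k s) 1)"
      \<comment> \<open>\<open>cdf\<close> requires \<open>k \<ge> 1\<close>, which holds on the
        support of \<open>blocks_pmf n\<close>.\<close>
      proof (rule integral_cong_AE)
        show "AE k in blocks_pmf n. measure (P k) {..s} = pmf (left_pmf k s) 1"
          by (rule AE_pmfI, rule cdf) (use set_blocks_pmf[of n] n in auto)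
      qed auto
      also have "\<dots> = pmf (left_pmf n t) 1"
        unfolding Suc left_pmf_first_step pmf_bind ..
      finally show ?thesis using n by (simp add: cdf)
    qed
  qed
  define D where "D n = distr (M n) borel (\<lambda>\<omega>. (real (X n \<omega>) - real n) / sqrt (real n))" for n
  have meas: "(\<lambda>\<omega>. (real (X n \<omega>) - real n) / sqrt (real n)) \<in> borel_measurable (M n)" if "n \<ge> 1" for n
    by (rule measurable_compose[OF assms(4)[OF that]]) simp
  have char: "char (D n) s =
      measure_pmf.expectation (P n) (\<lambda>t. iexp (s * ((real t - real n) / sqrt (real n))))" if n: "n \<ge> 1" for n s
  proof -
    have "char (D n) s = (CLINT \<omega>|M n. iexp (s * ((real (X n \<omega>) - real n) / sqrt (real n))))"
      unfolding D_def char_def by (subst integral_distr[OF meas[OF n]]) auto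
    also have "\<dots> = (CLINT t|distr (M n) (count_space UNIV) (X n). iexp (s * ((real t - real n) / sqrt (real n))))"
      by (subst integral_distr[OF assms(4)[OF n]]) auto
    finally show ?thesis using P[OF n] by simp
  qed
  \<comment> \<open>Levy's theorem needs every member of the sequence to be a real distribution,
    which is known from index 1 on; hence the shift, undone afterwards by
    \<open>LIMSEQ_imp_Suc\<close>.\<close>
  have "weak_conv_m (\<lambda>n. D (Suc n)) std_normal_distribution"
  proof (rule levy_continuity)
    show "real_distribution (D (Suc n))" for n
      unfolding D_def using prob_space.real_distribution_distr[OF assms(1)[of "Suc n"] meas[of "Suc n"]] by simp
    show "real_distribution std_normal_distribution" by (rule real_dist_normal_dist)
    fix s
    have "(\<lambda>n. char (D (Suc n)) s) = (\<lambda>n. measure_pmf.expectation (P (Suc n))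
        (\<lambda>t. iexp (s * ((real t - real (Suc n)) / sqrt (real (Suc n))))))"
      by (simp add: char fun_eq_iff)
    then show "(\<lambda>n. char (D (Suc n)) s) \<longlonglongrightarrow> char std_normal_distribution s"
      unfolding char_std_normal_distribution
      using LIMSEQ_Suc[OF char_fun_tendsto[OF P_1 P_step, of s]] by (simp only:)
  qed
  then have "weak_conv_m D std_normal_distribution"
    unfolding weak_conv_m_def weak_conv_def by (auto intro: LIMSEQ_imp_Suc)
  then show ?thesis unfolding D_def .
qed

end
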